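(* Let $\alpha\in[0,1]$ be irrational with best approximation denominators $q_0,q_1,q_2,\dots$. For all $N$ with $q_l\le N<q_{l+1}$ we have $$\frac1N\sum_{n=1}^N\log|2\sin(\pi n\alpha)|\le(\log 2)\left(\frac1{q_l}+\frac{l}{2^{(l-3)/2}}\right)+3\,\frac{\log q_l}{q_l}\left(\frac{\log q_l}{\log\phi}+1\right),$$ where $\phi=(1+\sqrt5)/2$, and hence $$\limsup_{N\to\infty}\frac1N\sum_{n=1}^N\log|2\sin(\pi n\alpha)|=0=\int_0^1\log(2\sin(\pi x))\,\mathrm dx.$$
   Context: The best approximation denominators of an irrational $\alpha=[0;a_1,a_2,\dots]\in[0,1]$ are the denominators of its continued fraction convergents: $q_0=1$, $q_1=a_1$, $q_{i+1}=a_{i+1}q_i+q_{i-1}$ for $i\ge1$. *)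

theory Defs
  imports "HOL-Analysis.Analysis"
begin

text \<open>
  Continued fraction expansion \<open>\<alpha> = [0; a\<^sub>1, a\<^sub>2, \<dots>]\<close> of an irrational \<open>\<alpha>\<close> in \<open>[0,1]\<close>, by iterating the
  Gauss map: \<open>\<alpha> = [0; a\<^sub>1, \<dots>, a\<^sub>n + cf_tail \<alpha> n]\<close>.
\<close>

primrec cf_tail :: "real \<Rightarrow> nat \<Rightarrow> real" where
  "cf_tail \<alpha> 0 = \<alpha>"
| "cf_tail \<alpha> (Suc n) = frac (1 / cf_tail \<alpha> n)"

text \<open>The partial quotients are indexed from 1; \<open>cf_quot \<alpha> 0\<close> is a dummy value that is never used.\<close>

definition cf_quot :: "real \<Rightarrow> nat \<Rightarrow> nat" where
  "cf_quot \<alpha> n = nat \<lfloor>1 / cf_tail \<alpha> (n - 1)\<rfloor>"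

fun cf_denom :: "real \<Rightarrow> nat \<Rightarrow> nat" where
  "cf_denom \<alpha> 0 = 1"
| "cf_denom \<alpha> (Suc 0) = cf_quot \<alpha> 1"
| "cf_denom \<alpha> (Suc (Suc n)) = cf_quot \<alpha> (Suc (Suc n)) * cf_denom \<alpha> (Suc n) + cf_denom \<alpha> n"

definition golden_ratio :: real where
  "golden_ratio = (1 + sqrt 5) / 2"

end

theory Submission
  imports
    Defs
    "HOL-Computational_Algebra.Fundamental_Theorem_Algebra"
    "HOL-Real_Asymp.Real_Asymp"
begin

text \<open>
  Since the product of \<open>2 \<bar>sin (pi (d + k / q))\<bar>\<close> over \<open>k < q\<close> is \<open>2 \<bar>sin (pi q d)\<bar> \<le> 2\<close>, a block of
  \<open>q\<^sub>l\<close> consecutive points \<open>n \<alpha> + x\<close>, which are close to equally spaced, has log-sum at most \<open>ln 2\<close>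
  up to an error of order \<open>(q\<^sub>l / q\<^bsub>l+1\<^esub>) ln q\<^sub>l\<close>. Cutting \<open>N\<close> greedily into such blocks gives the upper
  bound for \<open>l \<ge> 10\<close>; for smaller \<open>l\<close> the right-hand side is at least \<open>ln 2\<close>, which bounds each term.
  Conversely, for \<open>N = q\<^sub>l - 1\<close> concavity of the sine shows that the product is at least \<open>1 / q\<^sub>l\<^sup>3\<close>,
  so the limit superior is not negative.
\<close>

section \<open>Products of sines at equally spaced points\<close>

text \<open>The factor q_l / q_{l+1} in the block error must be kept: up to q_{l+1} / q_l blocks of
  length q_l can occur, so a large partial quotient would otherwise multiply the error without
  control. With it, level i costs about 2 ln q_i in total, besides ln 2 for each block. Since the
  denominators double every two steps, q_{i+1} / q_i is at most q_l / 2^((l-3)/2); this gives the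
  first part of the bound. The number of levels is at most log q_l / log phi + 1, which gives the
  second.

  The case split at 10 is where two ranges meet: the bound ln 2 suffices as long as 2^((l-3)/2) <=
  l, that is up to l = 9, and from l = 10 on q_l >= 89 > 3^4 > e^4 absorbs the constants of the
  block error.

  The lower bound stops at q_l - 1 because the next factor, n = q_l, is of order at most 1 /
  q_{l+1}, which no power of q_l controls from below.\<close>

lemma norm_one_minus_cis: "norm (1 - cis (2 * x)) = 2 * \<bar>sin x\<bar>"
proof -
  have "(norm (1 - cis (2 * x)))\<^sup>2 = (1 - cos (2 * x))\<^sup>2 + (sin (2 * x))\<^sup>2"
    by (simp add: cmod_power2)
  also have "\<dots> = 2 - 2 * cos (2 * x)"
    using sin_cos_squared_add[of "2 * x"] by (simp add: power2_eq_square algebra_simps)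
  also have "\<dots> = (2 * \<bar>sin x\<bar>)\<^sup>2"
    by (simp add: cos_double_sin power2_eq_square)
  finally show ?thesis
    by (rule power2_eq_imp_eq) auto
qed

text \<open>The derivative q X^(q-1) vanishes only at 0, so X^q - 1 has no multiple roots and splits
  into distinct monic linear factors.\<close>

lemma prod_minus_roots_of_unity:
  fixes z :: complex
  assumes "q > 0"
  shows "(\<Prod>k<q. z - cis (2 * pi * real k / real q)) = z ^ q - 1"
proof -
  define p :: "complex poly" where "p = monom 1 q - 1"
  have poly_p: "poly p w = w ^ q - 1" for w
    by (simp add: p_def poly_monom)
  have coeff: "coeff p q = 1" using assms by (simp add: p_def)
  have "degree p \<le> q" unfolding p_def by (intro degree_diff_le degree_monom_le) auto
  moreover have "degree p \<ge> q" using coeff by (intro le_degree) auto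
  ultimately have lead: "lead_coeff p = 1" using coeff by simp
  have pd: "poly (pderiv p) w = of_nat q * w ^ (q - 1)" for w
    by (simp add: p_def pderiv_diff pderiv_monom poly_monom)
  have "rsquarefree p" unfolding rsquarefree_roots poly_p pd
    using assms by (auto simp: zero_power)
  from complex_poly_decompose_rsquarefree[OF this]
  have "(\<Prod>w | w ^ q = 1. [:- w, 1:]) = p" by (simp add: lead poly_p)
  then have "poly (\<Prod>w | w ^ q = 1. [:- w, 1:]) z = poly p z" by simp
  then have "(\<Prod>w | w ^ q = 1. z - w) = z ^ q - 1"
    by (simp add: poly_prod poly_p)
  with prod.reindex_bij_betw[OF Complex.bij_betw_roots_unity[OF assms], of "\<lambda>w. z - w"]
  show ?thesis by simp
qed

lemma prod_minus_nontrivial_roots_of_unity: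
  fixes z :: complex
  assumes "q > 0"
  shows "(\<Prod>k=1..<q. z - cis (2 * pi * real k / real q)) = (\<Sum>j<q. z ^ j)"
proof -
  let ?P = "\<lambda>z::complex. (\<Prod>k=1..<q. z - cis (2 * pi * real k / real q))"
  have eq: "?P z = (\<Sum>j<q. z ^ j)" if "z \<noteq> 1" for z
  proof -
    have "{..<q} = insert 0 {1..<q}" using assms by auto
    then have "(z - 1) * ?P z = z ^ q - 1"
      using prod_minus_roots_of_unity[OF assms, of z] by simp
    also have "\<dots> = (z - 1) * (\<Sum>j<q. z ^ j)"
      by (simp add: power_diff_1_eq)
    finally show ?thesis using that by simp
  qed
  \<comment> \<open>Cancelling z - 1 leaves the point z = 1 open; there the identity follows because
    both sides are continuous.\<close>
  have cont: "isCont (\<lambda>z. ?P z - (\<Sum>j<q. z ^ j)) 1"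
    by (intro continuous_intros)
  have "((\<lambda>z. ?P z - (\<Sum>j<q. z ^ j)) \<longlongrightarrow> 0) (at 1)"
    by (rule Lim_transform_eventually[OF tendsto_const])
       (auto simp: eventually_at_filter eq simp del: One_nat_def)
  with cont have "?P 1 - (\<Sum>j<q. 1 ^ j) = 0"
    using LIM_unique isContD by blast
  then show ?thesis using eq by (cases "z = 1") auto
qed

text \<open>A chord of the unit circle, after a rotation. Products of such factors thus become
  values of X^q - 1, or of its quotient by X - 1 when k = 0 is left out.\<close>

lemma abs_sin_shift_eq_norm:
  "2 * \<bar>sin (pi * (d + real k / real q))\<bar> = norm (cis (- (2 * pi * d)) - cis (2 * pi * real k / real q))"
proof -
  have "norm (cis (- (2 * pi * d)) - cis (2 * pi * real k / real q))
      = norm (cis (- (2 * pi * d)) * (1 - cis (2 * (pi * (d + real k / real q)))))"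
  proof -
    have "cis (- (2 * pi * d)) * cis (2 * (pi * (d + real k / real q))) = cis (2 * pi * real k / real q)"
      unfolding cis_mult by (rule arg_cong[of _ _ cis]) (simp add: distrib_left)
    then show ?thesis by (simp only: right_diff_distrib mult_1_right)
  qed
  also have "\<dots> = 2 * \<bar>sin (pi * (d + real k / real q))\<bar>"
    by (simp only: norm_mult norm_cis norm_one_minus_cis mult_1)
  finally show ?thesis by simp
qed

text \<open>For |z| = 1 the triangle inequality bounds the geometric sum by q and z^q - 1 by 2. The
  version without k = 0 serves where that factor is replaced by an additive error.\<close>

lemma prod_abs_sin_shift_le:
  assumes "q > 0"
  shows "(\<Prod>k=1..<q. 2 * \<bar>sin (pi * (d + real k / real q))\<bar>) \<le> real q" (is "?Q \<le> _")
    and "2 * \<bar>sin (pi * d)\<bar> * (\<Prod>k=1..<q. 2 * \<bar>sin (pi * (d + real k / real q))\<bar>) \<le> 2"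
proof -
  define z where "z = cis (- (2 * pi * d))"
  have Q: "?Q = norm (\<Sum>j<q. z ^ j)"
    unfolding abs_sin_shift_eq_norm prod_norm
    using prod_minus_nontrivial_roots_of_unity[OF assms, of z] by (simp add: z_def)
  have "norm (\<Sum>j<q. z ^ j) \<le> (\<Sum>j<q. 1)"
    by (rule sum_norm_le) (simp add: z_def norm_power)
  with Q show "?Q \<le> real q" by simp
  have "2 * \<bar>sin (pi * d)\<bar> = norm (z - 1)"
    using abs_sin_shift_eq_norm[of d 0 q] by (simp add: z_def)
  then have "2 * \<bar>sin (pi * d)\<bar> * ?Q = norm (z ^ q - 1)"
    by (simp only: Q flip: norm_mult) (simp add: power_diff_1_eq)
  also have "\<dots> \<le> norm (z ^ q) + norm (1::complex)" by (rule norm_triangle_ineq4)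
  also have "\<dots> = 2" by (simp add: z_def norm_power)
  finally show "2 * \<bar>sin (pi * d)\<bar> * ?Q \<le> 2" .
qed

lemma prod_sin_eq:
  assumes "q > 0"
  shows "(\<Prod>k=1..<q. 2 * \<bar>sin (pi * (real k / real q))\<bar>) = real q"
proof -
  have "(\<Prod>k=1..<q. 2 * \<bar>sin (pi * (0 + real k / real q))\<bar>) = norm (\<Sum>j<q. (1::complex) ^ j)"
    unfolding abs_sin_shift_eq_norm prod_norm
    using prod_minus_nontrivial_roots_of_unity[OF assms, of 1] by simp
  then show ?thesis by simp
qed

section \<open>Blocks of length \<open>q\<close>: upper bound\<close>

lemma abs_sin_pi_int_add: "\<bar>sin (pi * (of_int j + t))\<bar> = \<bar>sin (pi * t)\<bar>"
proof -
  have "sin (pi * (of_int j + t)) = cos (pi * of_int j) * sin (pi * t)"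
    by (simp add: distrib_left sin_add)
  then show ?thesis by (simp add: abs_mult)
qed

lemma mult_cos_le_sin:
  fixes x :: real
  assumes "0 \<le> x" "x \<le> pi"
  shows "x * cos x \<le> sin x"
proof -
  have "sin 0 - 0 * cos 0 \<le> sin x - x * cos x"
  proof (rule DERIV_nonneg_imp_nondecreasing[OF assms(1)])
    fix y assume y: "0 \<le> y" "y \<le> x"
    have "((\<lambda>x. sin x - x * cos x) has_real_derivative y * sin y) (at y)"
      by (auto intro!: derivative_eq_intros)
    moreover have "y * sin y \<ge> 0"
      using y assms by (intro mult_nonneg_nonneg sin_ge_zero) auto
    ultimately show "\<exists>D. ((\<lambda>x. sin x - x * cos x) has_real_derivative D) (at y) \<and> 0 \<le> D"
      by blast
  qed
  then show ?thesis by simp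
qed

text \<open>On the left half x cos x <= sin x already gives 1 / z, and the reflection z -> 1 - z
  treats the right half. This controls pi |cot (pi z)|, the relative effect of a small shift on the
  sine.\<close>

lemma pi_abs_cos_le:
  assumes "0 < z" "z < 1"
  shows "pi * \<bar>cos (pi * z)\<bar> \<le> sin (pi * z) * (1 / z + 1 / (1 - z))"
proof -
  have half: "pi * \<bar>cos (pi * u)\<bar> \<le> sin (pi * u) * (1 / u + 1 / (1 - u))" if "0 < u" "u \<le> 1/2" for u
  proof -
    have "pi * u \<le> pi * (1/2)" using that by (intro mult_left_mono) auto
    then have "cos (pi * u) \<ge> 0"
      using that by (intro cos_ge_zero) (auto intro: order_trans[of _ 0])
    moreover have "pi * u * cos (pi * u) \<le> sin (pi * u)"
      using that by (intro mult_cos_le_sin) auto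
    ultimately have "pi * \<bar>cos (pi * u)\<bar> \<le> sin (pi * u) * (1 / u)"
      using that by (simp add: field_simps)
    also have "\<dots> \<le> sin (pi * u) * (1 / u + 1 / (1 - u))"
      using that by (intro mult_left_mono sin_ge_zero) auto
    finally show ?thesis .
  qed
  show ?thesis
  proof (cases "z \<le> 1/2")
    case True
    then show ?thesis using half assms by simp
  next
    case False
    have "sin (pi * (1 - z)) = sin (pi * z)" "cos (pi * (1 - z)) = - cos (pi * z)"
      by (simp_all add: right_diff_distrib sin_diff cos_diff)
    then show ?thesis using half[of "1 - z"] False assms by (simp add: add.commute)
  qed
qed

lemma abs_sin_add_le:
  assumes "\<bar>e\<bar> \<le> r"
  shows "\<bar>sin (pi * (z + e))\<bar> \<le> \<bar>sin (pi * z)\<bar> + pi * r * \<bar>cos (pi * z)\<bar>"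
proof -
  have "\<bar>sin (pi * (z + e))\<bar> = \<bar>sin (pi * z) * cos (pi * e) + cos (pi * z) * sin (pi * e)\<bar>"
    by (simp add: distrib_left sin_add)
  also have "\<dots> \<le> \<bar>sin (pi * z)\<bar> * \<bar>cos (pi * e)\<bar> + \<bar>cos (pi * z)\<bar> * \<bar>sin (pi * e)\<bar>"
    using abs_triangle_ineq by (metis abs_mult)
  also have "\<dots> \<le> \<bar>sin (pi * z)\<bar> * 1 + \<bar>cos (pi * z)\<bar> * (pi * r)"
  proof (intro add_mono mult_left_mono)
    have "\<bar>sin (pi * e)\<bar> \<le> \<bar>pi * e\<bar>" by (rule abs_sin_x_le_abs_x)
    also have "\<dots> \<le> pi * r" using assms by (simp add: abs_mult)
    finally show "\<bar>sin (pi * e)\<bar> \<le> pi * r" .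
  qed auto
  finally show ?thesis by (simp add: mult_ac)
qed

lemma sum_inverse_le_ln:
  assumes "q \<ge> 1"
  shows "(\<Sum>k=1..q. 1 / real k) \<le> 1 + ln (real q)"
  using assms
proof (induction q rule: dec_induct)
  case base
  then show ?case by simp
next
  case (step q)
  have "ln (real q / real (Suc q)) \<le> real q / real (Suc q) - 1"
    using step by (intro ln_le_minus_one) auto
  also have "\<dots> = - 1 / real (Suc q)" by (simp add: field_simps)
  finally have "1 / real (Suc q) \<le> ln (real (Suc q)) - ln (real q)"
    using step by (simp add: ln_div)
  then show ?case using step by simp
qed

lemma affine_mod_inj:
  fixes p m :: int and q :: nat
  assumes "coprime p (int q)" "(int i * p + m) mod int q = (int j * p + m) mod int q"
    "\<bar>int i - int j\<bar> < int q"
  shows "i = j"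
proof -
  have "int q dvd (int i * p + m) - (int j * p + m)"
    using assms(2) by (simp add: mod_eq_dvd_iff)
  then have "int q dvd (int i - int j) * p" by (simp add: algebra_simps)
  then have "int q dvd int i - int j"
    using assms(1) by (simp add: coprime_commute coprime_dvd_mult_left_iff)
  then show ?thesis using assms(3) by (metis abs_dvd_iff dvd_imp_le_int eq_iff_diff_eq_0 not_le of_nat_eq_iff abs_of_nat)
qed

lemma bij_betw_affine_mod:
  fixes p m :: int and q :: nat
  assumes "q > 0" "coprime p (int q)"
  shows "bij_betw (\<lambda>n. nat ((int n * p + m) mod int q)) {1..q} {..<q}"
proof -
  let ?f = "\<lambda>n. nat ((int n * p + m) mod int q)"
  have "inj_on ?f {1..q}"
  proof (rule inj_onI)
    fix i j assume ij: "i \<in> {1..q}" "j \<in> {1..q}" "?f i = ?f j"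
    then have "(int i * p + m) mod int q = (int j * p + m) mod int q"
      using assms(1) by (simp add: eq_nat_nat_iff)
    then show "i = j" using ij by (intro affine_mod_inj[OF assms(2)]) auto
  qed
  moreover have "?f ` {1..q} \<subseteq> {..<q}"
    using assms(1) by (auto simp: nat_less_iff)
  ultimately show ?thesis
    by (simp add: bij_betw_def card_image card_subset_eq)
qed

lemma bij_betw_mult_mod:
  fixes p :: int and q :: nat
  assumes "q > 0" "coprime p (int q)"
  shows "bij_betw (\<lambda>n. nat ((int n * p) mod int q)) {1..<q} {1..<q}"
proof -
  have "bij_betw (\<lambda>n. nat ((int n * p) mod int q)) ({1..q} - {q}) ({..<q} - {nat ((int q * p) mod int q)})"
    using bij_betw_affine_mod[OF assms, of 0] assms(1)
    by (subst bij_betw_DiffI) auto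
  moreover have "{1..q} - {q} = {1..<q}" "{..<q} - {nat ((int q * p) mod int q)} = {1..<q}" by auto
  ultimately show ?thesis by simp
qed

text \<open>As d + k/q >= (k - 1/2) / q >= k / (2 q), each reciprocal loses at most a factor 2
  against q / k; the second one is the same with q - k in place of k. Two harmonic sums
  remain.\<close>

lemma sum_two_sided_inverse_le:
  assumes "q \<ge> 1" "\<bar>d\<bar> \<le> 1 / (2 * real q)"
  shows "(\<Sum>k=1..<q. 1 / (d + real k / real q) + 1 / (1 - (d + real k / real q)))
    \<le> real q * (4 + 4 * ln (real q))"
proof -
  have le: "1 / u \<le> 2 * real q * (1 / real k)" if "k \<ge> 1" "u \<ge> real k / real q - 1 / (2 * real q)" for k u
  proof -
    have "real k / (2 * real q) \<le> real k / real q - 1 / (2 * real q)"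
      using that assms(1) by (simp add: field_simps)
    also have "\<dots> \<le> u" by (rule that)
    finally have "real k / (2 * real q) \<le> u" .
    moreover have "real k / (2 * real q) > 0" using that assms(1) by simp
    ultimately have "1 / u \<le> 1 / (real k / (2 * real q))" by (intro frac_le) simp_all
    then show ?thesis by simp
  qed
  have "(\<Sum>k=1..<q. 1 / (d + real k / real q) + 1 / (1 - (d + real k / real q)))
     \<le> (\<Sum>k=1..<q. 2 * real q * (1 / real k) + 2 * real q * (1 / real (q - k)))"
  proof (intro sum_mono add_mono)
    fix k assume k: "k \<in> {1..<q}"
    show "1 / (d + real k / real q) \<le> 2 * real q * (1 / real k)"
      using k assms(2) by (intro le) (auto simp: abs_le_iff)
    have "real (q - k) / real q = 1 - real k / real q"
      using k by (simp add: of_nat_diff field_simps)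
    then show "1 / (1 - (d + real k / real q)) \<le> 2 * real q * (1 / real (q - k))"
      using k assms(2) by (intro le) (auto simp: abs_le_iff)
  qed
  also have "\<dots> = 2 * real q * (\<Sum>k=1..<q. 1 / real k) + 2 * real q * (\<Sum>k=1..<q. 1 / real (q - k))"
    by (simp only: sum.distrib sum_distrib_left)
  also have "(\<Sum>k=1..<q. 1 / real (q - k)) = (\<Sum>k=1..<q. 1 / real k)"
    by (rule sum.reindex_bij_witness[of _ "\<lambda>k. q - k" "\<lambda>k. q - k"]) auto
  also have "2 * real q * (\<Sum>k=1..<q. 1 / real k) + 2 * real q * (\<Sum>k=1..<q. 1 / real k)
    = 4 * real q * (\<Sum>k=1..<q. 1 / real k)" by simp
  also have "\<dots> \<le> 4 * real q * (\<Sum>k=1..q. 1 / real k)"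
    by (intro mult_left_mono sum_mono2) auto
  also have "\<dots> \<le> 4 * real q * (1 + ln (real q))"
    by (intro mult_left_mono sum_inverse_le_ln assms) auto
  also have "\<dots> = real q * (4 + 4 * ln (real q))" by (simp add: algebra_simps)
  finally show ?thesis .
qed

lemma nearest_multiple:
  fixes y :: real
  assumes "q \<ge> 1"
  obtains m :: int and d :: real where "y = of_int m / real q + d" "\<bar>d\<bar> \<le> 1 / (2 * real q)"
proof
  define m where "m = round (real q * y)"
  define d where "d = y - of_int m / real q"
  show "y = of_int m / real q + d" by (simp add: d_def)
  have "real q * \<bar>d\<bar> = \<bar>of_int m - real q * y\<bar>"
    using assms by (simp add: d_def abs_mult[of "real q", simplified, symmetric] right_diff_distrib abs_minus_commute)
  also have "\<dots> \<le> 1 / 2" unfolding m_def by (rule of_int_round_abs_le)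
  finally show "\<bar>d\<bar> \<le> 1 / (2 * real q)" using assms by (simp add: field_simps)
qed

lemma abs_sin_mod:
  fixes p m :: int
  assumes "q \<ge> 1"
  shows "\<bar>sin (pi * ((real n * of_int p + of_int m) / real q + t))\<bar>
    = \<bar>sin (pi * (real (nat ((int n * p + m) mod int q)) / real q + t))\<bar>"
proof -
  let ?c = "int n * p + m"
  have "?c = int q * (?c div int q) + ?c mod int q" by simp
  then have "real_of_int ?c = real q * of_int (?c div int q) + of_int (?c mod int q)"
    by (metis of_int_add of_int_mult of_int_of_nat_eq)
  then have "(real n * of_int p + of_int m) / real q + t
    = of_int (?c div int q) + (real (nat (?c mod int q)) / real q + t)"
    using assms by (simp add: field_simps)
  then show ?thesis by (simp only: abs_sin_pi_int_add)
qed

text \<open>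
  The perturbations of the points \<open>n p / q\<close> are centred, so that none exceeds \<open>1 / (2 q')\<close>; the
  one factor that may come close to zero is estimated additively, the others multiplicatively.
\<close>

lemma prod_abs_sin_block_le:
  fixes p :: int and q q' :: nat and \<alpha> x :: real
  assumes "q \<ge> 1" "q' \<ge> 1" "coprime p (int q)" "\<bar>real q * \<alpha> - of_int p\<bar> \<le> 1 / real q'"
  shows "(\<Prod>n=1..q. 2 * \<bar>sin (pi * (real n * \<alpha> + x))\<bar>)
    \<le> 2 * exp (real q / real q' * (pi / 2 + 2 + 2 * ln (real q)))"
proof -
  define \<delta> where "\<delta> = \<alpha> - of_int p / real q"
  define r where "r = 1 / (2 * real q')"
  have q'0: "real q' > 0" using assms(2) by simp
  then have r0: "r > 0" by (simp add: r_def)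
  have "real q * \<bar>\<delta>\<bar> = \<bar>real q * \<alpha> - of_int p\<bar>"
    using assms(1) by (simp add: \<delta>_def abs_mult[of "real q", simplified, symmetric] right_diff_distrib)
  with assms(4) have \<delta>: "real q * \<bar>\<delta>\<bar> \<le> 2 * r" by (simp add: r_def)
  \<comment> \<open>The mean of n \<open>\<delta>\<close> over n = 1..q is moved into the offset,
    which leaves the centred errors \<open>e n\<close>. Rounding the offset to a multiple of 1/q
    makes k = 0 the only residue whose point can lie within 1 / (2 q) of an integer, up to boundary
    cases.\<close>
  obtain m d where md: "x + (real q + 1) / 2 * \<delta> = of_int m / real q + d" "\<bar>d\<bar> \<le> 1 / (2 * real q)"
    using nearest_multiple[OF assms(1)] by blast
  define e where "e n = (real n - (real q + 1) / 2) * \<delta>" for n :: nat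
  have e: "\<bar>e n\<bar> \<le> r" if "n \<in> {1..q}" for n
  proof -
    have "\<bar>real n - (real q + 1) / 2\<bar> \<le> real q / 2"
    proof -
      have "1 \<le> real n" "real n \<le> real q" using that by auto
      then show ?thesis unfolding abs_le_iff by (auto simp: field_simps)
    qed
    then have "\<bar>e n\<bar> \<le> real q / 2 * \<bar>\<delta>\<bar>"
      unfolding e_def abs_mult by (rule mult_right_mono) simp
    with \<delta> show ?thesis by simp
  qed
  have split: "real n * \<alpha> + x = (real n * of_int p + of_int m) / real q + (d + e n)" for n
    using md(1) assms(1) by (simp add: e_def \<delta>_def field_simps)
  define c where "c k = r * (1 / (d + real k / real q) + 1 / (1 - (d + real k / real q)))" for k
  \<comment> \<open>No relative error is possible for k = 0, since sin (pi d) may vanish.\<close>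
  define G where "G k = (if k = 0 then 2 * \<bar>sin (pi * d)\<bar> + 2 * pi * r
    else 2 * \<bar>sin (pi * (d + real k / real q))\<bar> * (1 + c k))" for k
  define h where "h n = nat ((int n * p + m) mod int q)" for n
  have range: "0 < d + real k / real q" "d + real k / real q < 1" if "k \<in> {1..<q}" for k
  proof -
    have "1 / (2 * real q) < 1 / real q" using assms(1) by (simp add: field_simps)
    also have "1 / real q \<le> real k / real q" using that by (intro divide_right_mono) auto
    finally show "0 < d + real k / real q" using md(2) by linarith
    have "real k / real q + 1 / real q \<le> 1" using that by (simp add: field_simps)
    then show "d + real k / real q < 1"
      using md(2) \<open>1 / (2 * real q) < 1 / real q\<close> by linarith
  qed
  have term_le: "2 * \<bar>sin (pi * (real n * \<alpha> + x))\<bar> \<le> G (h n)" if "n \<in> {1..q}" for n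
  proof -
    have "h n < q" using assms(1) by (simp add: h_def nat_less_iff)
    have "\<bar>sin (pi * (real n * \<alpha> + x))\<bar> = \<bar>sin (pi * (real (h n) / real q + (d + e n)))\<bar>"
      unfolding split h_def by (rule abs_sin_mod[OF assms(1)])
    also have "\<dots> = \<bar>sin (pi * ((d + real (h n) / real q) + e n))\<bar>"
      by (simp add: algebra_simps)
    also have "\<dots> \<le> \<bar>sin (pi * (d + real (h n) / real q))\<bar> + pi * r * \<bar>cos (pi * (d + real (h n) / real q))\<bar>"
      by (rule abs_sin_add_le[OF e[OF that]])
    finally have le: "\<bar>sin (pi * (real n * \<alpha> + x))\<bar> \<le> \<dots>" .
    show ?thesis
    proof (cases "h n = 0")
      case True
      have "pi * r * \<bar>cos (pi * d)\<bar> \<le> pi * r * 1"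
        using r0 by (intro mult_left_mono) auto
      moreover have "\<bar>sin (pi * (real n * \<alpha> + x))\<bar> \<le> \<bar>sin (pi * d)\<bar> + pi * r * \<bar>cos (pi * d)\<bar>"
        using le True by simp
      ultimately have "2 * \<bar>sin (pi * (real n * \<alpha> + x))\<bar> \<le> 2 * \<bar>sin (pi * d)\<bar> + 2 * pi * r"
        by linarith
      then show ?thesis using True by (simp add: G_def)
    next
      case False
      then have k: "h n \<in> {1..<q}" using \<open>h n < q\<close> by auto
      define z where "z = d + real (h n) / real q"
      have z: "0 < z" "z < 1" unfolding z_def using range[OF k] by auto
      then have abs: "\<bar>sin (pi * z)\<bar> = sin (pi * z)" by (intro abs_of_nonneg sin_ge_zero) auto
      have "\<bar>sin (pi * (real n * \<alpha> + x))\<bar> \<le> sin (pi * z) + r * (pi * \<bar>cos (pi * z)\<bar>)"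
        using le by (simp only: z_def[symmetric] abs mult_ac)
      also have "\<dots> \<le> sin (pi * z) + r * (sin (pi * z) * (1 / z + 1 / (1 - z)))"
        using r0 by (intro add_left_mono mult_left_mono pi_abs_cos_le z) auto
      also have "\<dots> = \<bar>sin (pi * z)\<bar> * (1 + r * (1 / z + 1 / (1 - z)))"
        unfolding abs by (simp add: algebra_simps)
      finally show ?thesis using False by (simp add: G_def c_def z_def)
    qed
  qed
  define Q where "Q = (\<Prod>k=1..<q. 2 * \<bar>sin (pi * (d + real k / real q))\<bar>)"
  have Q: "0 \<le> Q" "Q \<le> real q" "2 * \<bar>sin (pi * d)\<bar> * Q \<le> 2"
    using prod_abs_sin_shift_le[of q d] assms(1) by (auto simp: Q_def intro!: prod_nonneg)
  have c0: "c k \<ge> 0" if "k \<in> {1..<q}" for k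
    using range[OF that] r0 by (simp add: c_def)
  define E where "E = real q / real q' * (2 + 2 * ln (real q))"
  have "(\<Prod>k=1..<q. 1 + c k) \<le> (\<Prod>k=1..<q. exp (c k))"
    using c0 by (intro prod_mono) (auto simp: add_nonneg_nonneg)
  also have "\<dots> = exp (\<Sum>k=1..<q. c k)" by (simp add: exp_sum)
  also have "(\<Sum>k=1..<q. c k) \<le> r * (real q * (4 + 4 * ln (real q)))"
    unfolding c_def sum_distrib_left[symmetric]
    using r0 by (intro mult_left_mono sum_two_sided_inverse_le assms md) auto
  also have "\<dots> = E" using q'0 by (simp add: r_def E_def field_simps)
  finally have prodc: "(\<Prod>k=1..<q. 1 + c k) \<le> exp E" by simp
  have "(\<Prod>n=1..q. 2 * \<bar>sin (pi * (real n * \<alpha> + x))\<bar>) \<le> (\<Prod>n=1..q. G (h n))"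
    using term_le by (intro prod_mono) auto
  also have "\<dots> = (\<Prod>k<q. G k)"
    unfolding h_def by (intro prod.reindex_bij_betw bij_betw_affine_mod) (use assms in auto)
  also have "{..<q} = insert 0 {1..<q}" using assms(1) by auto
  also have "(\<Prod>k\<in>insert 0 {1..<q}. G k) = G 0 * (\<Prod>k=1..<q. G k)" by simp
  also have "(\<Prod>k=1..<q. G k) = Q * (\<Prod>k=1..<q. 1 + c k)"
    unfolding Q_def prod.distrib[symmetric] by (intro prod.cong) (auto simp: G_def)
  \<comment> \<open>The main term completes the product, which is then at most 2; the additive error
    only meets the product without k = 0, which is at most q.\<close>
  also have "G 0 * (Q * (\<Prod>k=1..<q. 1 + c k)) = (2 * \<bar>sin (pi * d)\<bar> * Q + 2 * pi * r * Q) * (\<Prod>k=1..<q. 1 + c k)"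
    by (simp add: G_def algebra_simps)
  also have "\<dots> \<le> (2 + 2 * pi * r * real q) * exp E"
    using Q r0 c0 by (intro mult_mono prodc add_mono mult_left_mono) (auto intro!: prod_nonneg add_nonneg_nonneg)
  also have "\<dots> = 2 * (1 + real q / real q' * (pi / 2)) * exp E"
    using q'0 by (simp add: r_def field_simps)
  also have "\<dots> \<le> 2 * exp (real q / real q' * (pi / 2)) * exp E"
    by (intro mult_mono) auto
  also have "\<dots> = 2 * exp (real q / real q' * (pi / 2 + 2 + 2 * ln (real q)))"
    by (simp add: E_def algebra_simps flip: exp_add)
  finally show ?thesis .
qed

section \<open>Continued fraction convergents\<close>

text \<open>Numerators of the convergents, started from 0/1 and 1/a_1; integers, because they enter
  alternating differences.\<close>

fun cf_numer :: "real \<Rightarrow> nat \<Rightarrow> int" where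
  "cf_numer \<alpha> 0 = 0"
| "cf_numer \<alpha> (Suc 0) = 1"
| "cf_numer \<alpha> (Suc (Suc n)) = int (cf_quot \<alpha> (Suc (Suc n))) * cf_numer \<alpha> (Suc n) + cf_numer \<alpha> n"

locale unit_irrational =
  fixes \<alpha> :: real
  assumes unit: "0 < \<alpha>" "\<alpha> < 1" and irrational: "\<alpha> \<notin> \<rat>"
begin

text \<open>Irrationality survives taking reciprocals and removing integer parts. Hence no tail is 0
  and the expansion never stops.\<close>

lemma cf_tail_irrational: "cf_tail \<alpha> n \<notin> \<rat>"
proof (induction n)
  case 0
  then show ?case using irrational by simp
next
  case (Suc n)
  have "cf_tail \<alpha> n \<in> \<rat>" if "frac (1 / cf_tail \<alpha> n) \<in> \<rat>"
  proof -
    have "1 / cf_tail \<alpha> n = of_int \<lfloor>1 / cf_tail \<alpha> n\<rfloor> + frac (1 / cf_tail \<alpha> n)"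
      by (simp add: frac_def)
    also have "\<dots> \<in> \<rat>" using that by (intro Rats_add) auto
    finally have "inverse (1 / cf_tail \<alpha> n) \<in> \<rat>" by (rule Rats_inverse)
    then show ?thesis by simp
  qed
  with Suc show ?case by auto
qed

lemma cf_tail_pos: "0 < cf_tail \<alpha> n" and cf_tail_less_1: "cf_tail \<alpha> n < 1"
proof -
  have "cf_tail \<alpha> n \<noteq> 0" using cf_tail_irrational[of n] by auto
  moreover have "0 \<le> cf_tail \<alpha> n" using unit by (cases n) auto
  ultimately show "0 < cf_tail \<alpha> n" by simp
  show "cf_tail \<alpha> n < 1" using unit by (cases n) (auto simp: frac_lt_1)
qed

lemma inverse_cf_tail: "1 / cf_tail \<alpha> n = real (cf_quot \<alpha> (Suc n)) + cf_tail \<alpha> (Suc n)"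
proof -
  have "\<lfloor>1 / cf_tail \<alpha> n\<rfloor> \<ge> 0" using cf_tail_pos[of n] by simp
  then show ?thesis by (simp add: cf_quot_def frac_def)
qed

lemma cf_quot_pos: "cf_quot \<alpha> (Suc n) \<ge> 1"
proof -
  have "1 / cf_tail \<alpha> n > 1" using cf_tail_pos[of n] cf_tail_less_1[of n] by simp
  then have "\<lfloor>1 / cf_tail \<alpha> n\<rfloor> \<ge> 1" by linarith
  then have "nat \<lfloor>1 / cf_tail \<alpha> n\<rfloor> \<ge> nat 1" by (rule nat_mono)
  then show ?thesis by (simp add: cf_quot_def)
qed

lemma cf_denom_pos: "cf_denom \<alpha> n \<ge> 1"
proof -
  have "cf_denom \<alpha> n \<ge> 1 \<and> cf_denom \<alpha> (Suc n) \<ge> 1"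
    using cf_quot_pos by (induction n) (auto simp: cf_quot_pos[of 0, simplified])
  then show ?thesis by simp
qed

lemma cf_denom_Suc_Suc_ge: "cf_denom \<alpha> (Suc n) + cf_denom \<alpha> n \<le> cf_denom \<alpha> (Suc (Suc n))"
  using cf_quot_pos[of "Suc n"] by simp

lemma cf_denom_le_Suc: "cf_denom \<alpha> n \<le> cf_denom \<alpha> (Suc n)"
proof (cases n)
  case 0
  then show ?thesis using cf_denom_pos[of 1] by simp
next
  case (Suc m)
  then show ?thesis using cf_denom_Suc_Suc_ge[of m] by (simp del: cf_denom.simps)
qed

lemma cf_denom_mono: "m \<le> n \<Longrightarrow> cf_denom \<alpha> m \<le> cf_denom \<alpha> n"
  by (rule lift_Suc_mono_le) (rule cf_denom_le_Suc)

text \<open>Doubling in two steps: q_{n+2} >= q_{n+1} + q_n >= 2 q_n.\<close>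

lemma cf_denom_add_ge: "2 ^ (d div 2) * cf_denom \<alpha> n \<le> cf_denom \<alpha> (n + d)"
proof (induction d rule: nat_induct2)
  case 0
  then show ?case by simp
next
  case 1
  then show ?case using cf_denom_le_Suc by simp
next
  case (step d)
  have "2 * cf_denom \<alpha> (n + d) \<le> cf_denom \<alpha> (n + d + 2)"
    using cf_denom_Suc_Suc_ge[of "n + d"] cf_denom_le_Suc[of "n + d"] by (simp del: cf_denom.simps)
  then show ?case using step by (simp del: cf_denom.simps)
qed

text \<open>Powers of phi satisfy the Fibonacci recurrence, which is the slowest growth allowed. The
  index shift is forced: q_1 = 1 < phi is possible.\<close>

lemma golden_ratio_power_le_cf_denom: "golden_ratio ^ n \<le> real (cf_denom \<alpha> (Suc n))"
proof -
  have sq: "golden_ratio ^ (n + 2) = golden_ratio ^ (n + 1) + golden_ratio ^ n" for n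
  proof -
    have "golden_ratio\<^sup>2 = golden_ratio + 1"
      by (simp add: golden_ratio_def power2_eq_square field_simps)
    then have "golden_ratio ^ n * golden_ratio\<^sup>2 = golden_ratio ^ n * (golden_ratio + 1)" by simp
    then show ?thesis by (simp only: power_add power_one_right distrib_left mult_1_right)
  qed
  have "sqrt 5 \<le> sqrt (3\<^sup>2)" by (intro real_sqrt_le_mono) simp
  then have "golden_ratio \<le> 2" by (simp add: golden_ratio_def)
  moreover have "cf_denom \<alpha> 2 \<ge> 2"
    using cf_denom_Suc_Suc_ge[of 0] cf_denom_pos[of 1] by (simp add: numeral_2_eq_2)
  ultimately have base: "golden_ratio \<le> real (cf_denom \<alpha> 2)" by linarith
  have "golden_ratio ^ n \<le> real (cf_denom \<alpha> (Suc n)) \<and> golden_ratio ^ (n + 1) \<le> real (cf_denom \<alpha> (Suc (n + 1)))"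
  proof (induction n)
    case 0
    then show ?case using base cf_denom_pos[of 1]
      by (simp add: numeral_2_eq_2 del: cf_denom.simps)
  next
    case (Suc n)
    have "real (cf_denom \<alpha> (Suc (Suc n))) + real (cf_denom \<alpha> (Suc n)) \<le> real (cf_denom \<alpha> (Suc (Suc (Suc n))))"
      using cf_denom_Suc_Suc_ge[of "Suc n"] by linarith
    with Suc sq[of n] show ?case by (simp del: cf_denom.simps)
  qed
  then show ?thesis by simp
qed

text \<open>89 is the Fibonacci number that ten steps of the recurrence with all partial quotients 1
  reach; it exceeds 3^4 = 81.\<close>

lemma cf_denom_ge_89: "n \<ge> 10 \<Longrightarrow> cf_denom \<alpha> n \<ge> 89"
proof -
  assume n: "n \<ge> 10"
  have "cf_denom \<alpha> 10 \<ge> 89"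
    using cf_denom_Suc_Suc_ge[of 0] cf_denom_Suc_Suc_ge[of 1] cf_denom_Suc_Suc_ge[of 2]
      cf_denom_Suc_Suc_ge[of 3] cf_denom_Suc_Suc_ge[of 4] cf_denom_Suc_Suc_ge[of 5]
      cf_denom_Suc_Suc_ge[of 6] cf_denom_Suc_Suc_ge[of 7] cf_denom_Suc_Suc_ge[of 8]
      cf_denom_pos[of 0] cf_denom_pos[of 1]
    by (simp add: numeral_eq_Suc del: cf_denom.simps)
  with cf_denom_mono[OF n] show ?thesis by simp
qed

text \<open>Inductively, the previous error is -(a_{n+2} + t_{n+2}) times the current one, t
  denoting the tails; in the recurrence for the next error the terms with a_{n+2} cancel.\<close>

lemma cf_error_Suc:
  "real (cf_denom \<alpha> (Suc n)) * \<alpha> - of_int (cf_numer \<alpha> (Suc n))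
    = - cf_tail \<alpha> (Suc n) * (real (cf_denom \<alpha> n) * \<alpha> - of_int (cf_numer \<alpha> n))"
proof (induction n)
  case 0
  have "\<alpha> * (1 / \<alpha>) = \<alpha> * (real (cf_quot \<alpha> 1) + cf_tail \<alpha> 1)"
    using inverse_cf_tail[of 0] by simp
  then show ?case using unit by (simp add: algebra_simps)
next
  case (Suc n)
  let ?b = "\<lambda>n. real (cf_denom \<alpha> n) * \<alpha> - of_int (cf_numer \<alpha> n)"
  let ?t = "cf_tail \<alpha> (Suc n)" and ?t' = "cf_tail \<alpha> (Suc (Suc n))"
  have "?b n = - (1 / ?t) * ?b (Suc n)"
    using cf_tail_pos[of "Suc n"] by (simp only: Suc) (simp add: field_simps)
  also have "\<dots> = - (real (cf_quot \<alpha> (Suc (Suc n))) + ?t') * ?b (Suc n)"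
    by (simp only: inverse_cf_tail)
  finally show ?case by (simp add: algebra_simps del: cf_tail.simps)
qed

lemma cf_determinant:
  "cf_numer \<alpha> (Suc n) * int (cf_denom \<alpha> n) - cf_numer \<alpha> n * int (cf_denom \<alpha> (Suc n)) = (- 1) ^ n"
  by (induction n) (simp_all add: algebra_simps)

lemma coprime_cf: "coprime (cf_numer \<alpha> n) (int (cf_denom \<alpha> n))"
proof (rule coprimeI)
  fix c assume "c dvd cf_numer \<alpha> n" "c dvd int (cf_denom \<alpha> n)"
  then have "c dvd (- 1) ^ n"
    unfolding cf_determinant[of n, symmetric] by (intro dvd_diff dvd_mult dvd_mult2)
  then show "is_unit c" using dvd_trans[of c "(-1) ^ n" 1] by (cases "even n") auto
qed

text \<open>Inserting \<open>b' = - ?t * b\<close> into the determinant identity gives |b| (q' + t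
  q) = 1, and t q >= 0.\<close>

lemma cf_error_le: "\<bar>real (cf_denom \<alpha> n) * \<alpha> - of_int (cf_numer \<alpha> n)\<bar> \<le> 1 / real (cf_denom \<alpha> (Suc n))"
proof -
  define b where "b = real (cf_denom \<alpha> n) * \<alpha> - of_int (cf_numer \<alpha> n)"
  define b' where "b' = real (cf_denom \<alpha> (Suc n)) * \<alpha> - of_int (cf_numer \<alpha> (Suc n))"
  let ?q = "real (cf_denom \<alpha> n)" and ?q' = "real (cf_denom \<alpha> (Suc n))" and ?t = "cf_tail \<alpha> (Suc n)"
  have b': "b' = - ?t * b" unfolding b_def b'_def by (rule cf_error_Suc)
  have "b * ?q' - b' * ?q = real_of_int (cf_numer \<alpha> (Suc n) * int (cf_denom \<alpha> n) - cf_numer \<alpha> n * int (cf_denom \<alpha> (Suc n)))"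
    by (simp add: b_def b'_def algebra_simps del: cf_denom.simps cf_numer.simps)
  also have "\<dots> = (- 1) ^ n" unfolding cf_determinant by simp
  finally have "b * (?q' + ?t * ?q) = (- 1) ^ n" by (simp add: b' algebra_simps del: cf_denom.simps cf_tail.simps)
  then have "\<bar>b\<bar> * \<bar>?q' + ?t * ?q\<bar> = 1" by (simp only: flip: abs_mult) simp
  moreover have "?t * ?q \<ge> 0" using cf_tail_pos[of "Suc n"] by (simp del: cf_tail.simps)
  moreover have "?q' > 0" using cf_denom_pos[of "Suc n"] by simp
  ultimately have "\<bar>b\<bar> * ?q' \<le> 1"
    by (metis abs_ge_zero abs_of_nonneg add_increasing2 le_add_same_cancel1 less_imp_le mult_left_mono)
  then show ?thesis using \<open>?q' > 0\<close> unfolding b_def by (simp add: pos_le_divide_eq del: cf_denom.simps)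
qed

end

section \<open>Blocks of length \<open>q - 1\<close>: lower bound\<close>

text \<open>Concavity with sin 0 = 0: the difference has derivative c (cos (c y) - cos y), which is
  nonnegative because the cosine decreases on [0, pi].\<close>

lemma sin_mult_ge:
  fixes x c :: real
  assumes "0 \<le> x" "x \<le> pi" "0 \<le> c" "c \<le> 1"
  shows "c * sin x \<le> sin (c * x)"
proof -
  have "sin (c * 0) - c * sin 0 \<le> sin (c * x) - c * sin x"
  proof (rule DERIV_nonneg_imp_nondecreasing[OF assms(1)])
    fix y assume y: "0 \<le> y" "y \<le> x"
    have "((\<lambda>x. sin (c * x) - c * sin x) has_real_derivative c * (cos (c * y) - cos y)) (at y)"
      by (auto intro!: derivative_eq_intros simp: algebra_simps)
    moreover have "cos y \<le> cos (c * y)"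
      using y assms by (intro cos_monotone_0_pi_le) (auto simp: mult_left_le_one_le)
    ultimately show "\<exists>D. ((\<lambda>x. sin (c * x) - c * sin x) has_real_derivative D) (at y) \<and> 0 \<le> D"
      using mult_nonneg_nonneg[of c "cos (c * y) - cos y"] assms by auto
  qed
  then show ?thesis by simp
qed

text \<open>A shift towards 0 scales the argument by at least 1 - c/k, so concavity yields that
  factor; a shift towards 1 is its mirror image and yields the one with q - k. Taking both factors
  makes the bound independent of the sign of \<open>e\<close>.\<close>

lemma abs_sin_perturbed_ge:
  assumes "1 \<le> k" "k < q" "0 \<le> c" "c \<le> 1" "\<bar>e\<bar> \<le> c / real q"
  shows "(1 - c / real k) * (1 - c / real (q - k)) * \<bar>sin (pi * (real k / real q))\<bar>
    \<le> \<bar>sin (pi * (real k / real q + e))\<bar>"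
proof -
  have below: "(1 - c / real k) * (1 - c / real (q - k)) * \<bar>sin (pi * (real k / real q))\<bar>
      \<le> \<bar>sin (pi * (real k / real q - s))\<bar>" if "1 \<le> k" "k < q" "0 \<le> s" "s \<le> c / real q" for k s
  proof -
    define v where "v = 1 - s * real q / real k"
    have "s * real q \<le> c" using that by (simp add: field_simps)
    then have v1: "1 - c / real k \<le> v" unfolding v_def using that by (simp add: divide_right_mono)
    have "c / real k \<le> 1" using that assms by (simp add: field_simps)
    then have ck: "0 \<le> 1 - c / real k" by simp
    have "c / real (q - k) \<le> 1" using that assms by (simp add: field_simps)
    then have cqk: "0 \<le> 1 - c / real (q - k)" "1 - c / real (q - k) \<le> 1" using assms by auto
    have "0 \<le> v" using v1 ck by linarith
    moreover have "v \<le> 1" using that by (simp add: v_def)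
    ultimately have v: "0 \<le> v" "v \<le> 1" .
    have z: "0 \<le> pi * (real k / real q)" "pi * (real k / real q) \<le> pi"
      using that by (auto simp: field_simps)
    then have s0: "0 \<le> sin (pi * (real k / real q))" by (intro sin_ge_zero)
    have "(1 - c / real k) * (1 - c / real (q - k)) * sin (pi * (real k / real q))
       \<le> v * 1 * sin (pi * (real k / real q))"
      using v1 ck cqk v s0 by (intro mult_right_mono mult_mono) auto
    also have "\<dots> \<le> sin (v * (pi * (real k / real q)))"
      using sin_mult_ge[OF z v] by simp
    also have "v * (pi * (real k / real q)) = pi * (real k / real q - s)"
      using that by (simp add: v_def field_simps)
    finally show ?thesis using s0 by linarith
  qed
  show ?thesis
  proof (cases "e \<le> 0")
    case True
    then show ?thesis using below[of k "- e"] assms by simp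
  next
    case False
    have "real (q - k) / real q = 1 - real k / real q"
      using assms by (simp add: of_nat_diff field_simps)
    then have "sin (pi * (real (q - k) / real q - e)) = sin (pi * (real k / real q + e))"
      "sin (pi * (real (q - k) / real q)) = sin (pi * (real k / real q))"
      by (metis diff_diff_eq right_diff_distrib mult_1_right sin_pi_minus)+
    then show ?thesis using below[of "q - k" e] False assms by (simp add: mult.commute)
  qed
qed

text \<open>Keep the factor k = 1 and replace c by 1 in all others: the product of 1 - 1/k over k =
  2..m telescopes to 1/m.\<close>

lemma prod_one_minus_ge:
  fixes c :: real
  assumes "m \<ge> 1" "0 \<le> c" "c \<le> 1"
  shows "(1 - c) / real m \<le> (\<Prod>k=1..m. 1 - c / real k)"
  using assms(1)
proof (induction m rule: dec_induct)
  case base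
  then show ?case by simp
next
  case (step m)
  have "(1 - c) / real (Suc m) = (1 - c) / real m * (1 - 1 / real (Suc m))"
  proof -
    have "1 - 1 / real (Suc m) = real m / real (Suc m)" by (simp add: field_simps)
    then show ?thesis using step by simp
  qed
  also have "\<dots> \<le> (\<Prod>k=1..m. 1 - c / real k) * (1 - c / real (Suc m))"
  proof (intro mult_mono step.IH)
    show "1 - 1 / real (Suc m) \<le> 1 - c / real (Suc m)"
      using assms by (simp add: divide_right_mono)
    show "0 \<le> (\<Prod>k=1..m. 1 - c / real k)"
      using assms by (intro prod_nonneg) (auto simp: field_simps)
  qed auto
  finally show ?case by simp
qed

lemma prod_abs_sin_ge:
  fixes p :: int and q :: nat
  assumes "q \<ge> 2" "coprime p (int q)" "\<bar>real q * \<alpha> - of_int p\<bar> \<le> 1 / real q"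
  shows "1 / real q ^ 3 \<le> (\<Prod>n=1..<q. 2 * \<bar>sin (pi * (real n * \<alpha>))\<bar>)"
proof -
  \<comment> \<open>As n <= q - 1, the point n \<open>\<alpha>\<close> is off by at most (q - 1) /
    q^2 = c / q. Being below 1, this c leaves 1 - c = 1/q positive.\<close>
  define c where "c = 1 - 1 / real q"
  have c: "0 \<le> c" "c \<le> 1" using assms(1) by (auto simp: c_def)
  define h where "h n = nat ((int n * p) mod int q)" for n
  have bij: "bij_betw h {1..<q} {1..<q}"
    unfolding h_def using assms by (intro bij_betw_mult_mod) auto
  define g where "g k = 2 * ((1 - c / real k) * (1 - c / real (q - k)) * \<bar>sin (pi * (real k / real q))\<bar>)" for k
  have g0: "0 \<le> g k" if "k \<in> {1..<q}" for k
  proof -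
    have "c / real k \<le> 1" "c / real (q - k) \<le> 1" using that c by (auto simp: field_simps)
    then show ?thesis by (simp add: g_def)
  qed
  have ge: "g (h n) \<le> 2 * \<bar>sin (pi * (real n * \<alpha>))\<bar>" if n: "n \<in> {1..<q}" for n
  proof -
    define e where "e = real n * (\<alpha> - of_int p / real q)"
    have "real q * (real q * \<bar>\<alpha> - of_int p / real q\<bar>) = real q * \<bar>real q * \<alpha> - of_int p\<bar>"
      using assms(1) by (simp add: abs_mult[of "real q", simplified, symmetric] right_diff_distrib)
    also have "\<dots> \<le> real q * (1 / real q)" using assms(3) by (intro mult_left_mono) auto
    also have "\<dots> = 1" using assms(1) by simp
    finally have \<delta>: "real q * (real q * \<bar>\<alpha> - of_int p / real q\<bar>) \<le> 1" .
    have "real q * (real q * \<bar>e\<bar>) = real n * (real q * (real q * \<bar>\<alpha> - of_int p / real q\<bar>))"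
      by (simp add: e_def abs_mult)
    also have "\<dots> \<le> real n * 1" by (intro mult_left_mono \<delta>) auto
    also have "\<dots> \<le> real q - 1" using n by auto
    finally have "\<bar>e\<bar> \<le> c / real q" using assms(1) by (simp add: c_def field_simps)
    moreover have "h n \<in> {1..<q}" using bij n by (auto simp: bij_betw_def)
    ultimately have "g (h n) \<le> 2 * \<bar>sin (pi * (real (h n) / real q + e))\<bar>"
      unfolding g_def using c by (intro mult_left_mono abs_sin_perturbed_ge) auto
    also have "\<bar>sin (pi * (real (h n) / real q + e))\<bar> = \<bar>sin (pi * ((real n * of_int p + of_int 0) / real q + e))\<bar>"
      using assms(1) by (subst abs_sin_mod) (auto simp: h_def)
    also have "(real n * of_int p + of_int 0) / real q + e = real n * \<alpha>"
      using assms(1) by (simp add: e_def field_simps)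
    finally show ?thesis .
  qed
  define R where "R = (\<Prod>k=1..<q. 1 - c / real k)"
  have "{1..<q} = {1..q - 1}" by auto
  then have "(1 - c) / real (q - 1) \<le> R"
    unfolding R_def using prod_one_minus_ge[of "q - 1" c] c assms(1) by simp
  moreover have "1 / real q ^ 2 \<le> (1 - c) / real (q - 1)"
    using assms(1) by (simp add: c_def power2_eq_square of_nat_diff field_simps)
  ultimately have R: "1 / real q ^ 2 \<le> R" by simp
  \<comment> \<open>Each of the two correction products contributes q^(-2), and the unperturbed sine
    product is exactly q.\<close>
  have "1 / real q ^ 3 = (1 / real q ^ 2) * (1 / real q ^ 2) * real q"
    using assms(1) by (simp add: field_simps power2_eq_square power3_eq_cube)
  also have "\<dots> \<le> R * R * real q"
    using R by (intro mult_right_mono mult_mono) (auto intro: order_trans[OF _ R])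
  also have "\<dots> = R * (\<Prod>k=1..<q. 1 - c / real (q - k)) * (\<Prod>k=1..<q. 2 * \<bar>sin (pi * (real k / real q))\<bar>)"
  proof -
    have "R = (\<Prod>k=1..<q. 1 - c / real (q - k))"
      unfolding R_def by (rule prod.reindex_bij_witness[of _ "\<lambda>k. q - k" "\<lambda>k. q - k"]) auto
    then show ?thesis using prod_sin_eq[of q] assms(1) by simp
  qed
  also have "\<dots> = (\<Prod>k=1..<q. g k)"
    unfolding R_def g_def prod.distrib[symmetric] by (intro prod.cong) auto
  also have "\<dots> = (\<Prod>n=1..<q. g (h n))"
    by (rule prod.reindex_bij_betw[OF bij, symmetric])
  also have "\<dots> \<le> (\<Prod>n=1..<q. 2 * \<bar>sin (pi * (real n * \<alpha>))\<bar>)"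
  proof (rule prod_mono, intro conjI ge)
    fix n assume "n \<in> {1..<q}"
    then show "0 \<le> g (h n)" using bij by (intro g0) (auto simp: bij_betw_def)
  qed
  finally show ?thesis .
qed

section \<open>Averages of the logarithm of the sine\<close>

context unit_irrational
begin

lemma sin_multiple_nonzero:
  assumes "n \<ge> 1"
  shows "sin (pi * (real n * \<alpha>)) \<noteq> 0"
proof
  assume "sin (pi * (real n * \<alpha>)) = 0"
  then obtain i :: int where "pi * (real n * \<alpha>) = of_int i * pi"
    by (auto simp: sin_zero_iff_int2)
  then have "real n * \<alpha> = of_int i" by (simp add: mult.commute)
  then have "\<alpha> = of_int i / real n" using assms by (simp add: field_simps)
  then have "\<alpha> \<in> \<rat>" by simp
  with irrational show False by blast
qed

lemma abs_sin_multiple_pos: "n \<ge> 1 \<Longrightarrow> 0 < 2 * \<bar>sin (pi * (real (n + j) * \<alpha>))\<bar>"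
  using sin_multiple_nonzero[of "n + j"] by simp

text \<open>The offset \<open>j\<close> is there because greedy cutting produces windows that start
  anywhere; the block bound holds uniformly in it.\<close>

definition log_sin_sum :: "nat \<Rightarrow> nat \<Rightarrow> real" where
  "log_sin_sum j N = (\<Sum>n=1..N. ln (2 * \<bar>sin (pi * (real (n + j) * \<alpha>))\<bar>))"

lemma log_sin_sum_add: "log_sin_sum j (M + N) = log_sin_sum j M + log_sin_sum (j + M) N"
proof -
  have "{1..M + N} = {1..M} \<union> {1 + M..N + M}" by auto
  moreover have "{1..M} \<inter> {1 + M..N + M} = {}" by auto
  ultimately show ?thesis
    unfolding log_sin_sum_def
    by (simp only: sum.union_disjoint finite_atLeastAtMost sum.shift_bounds_cl_nat_ivl) (simp add: ac_simps)
qed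

lemma log_sin_sum_eq_ln_prod:
  "log_sin_sum j N = ln (\<Prod>n=1..N. 2 * \<bar>sin (pi * (real (n + j) * \<alpha>))\<bar>)"
  unfolding log_sin_sum_def
  using abs_sin_multiple_pos by (intro ln_prod[symmetric]) force+

lemma log_sin_sum_le_trivial: "log_sin_sum j N \<le> real N * ln 2"
proof -
  have "log_sin_sum j N \<le> (\<Sum>n=1..N. ln 2)"
    unfolding log_sin_sum_def
    by (intro sum_mono ln_mono abs_sin_multiple_pos) auto
  then show ?thesis by simp
qed

definition block_error :: "nat \<Rightarrow> real" where
  "block_error i = pi / 2 + 2 + 2 * ln (real (cf_denom \<alpha> i))"

lemma ln_cf_denom_nonneg: "0 \<le> ln (real (cf_denom \<alpha> i))"
  using cf_denom_pos[of i] by (intro ln_ge_zero) auto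

lemma block_error_nonneg: "0 \<le> block_error i"
  unfolding block_error_def using ln_cf_denom_nonneg[of i] pi_ge_zero by simp

lemma log_sin_sum_block_le:
  "log_sin_sum j (cf_denom \<alpha> i)
    \<le> ln 2 + real (cf_denom \<alpha> i) / real (cf_denom \<alpha> (Suc i)) * block_error i"
proof -
  let ?P = "\<Prod>n=1..cf_denom \<alpha> i. 2 * \<bar>sin (pi * (real (n + j) * \<alpha>))\<bar>"
  let ?E = "real (cf_denom \<alpha> i) / real (cf_denom \<alpha> (Suc i)) * block_error i"
  have "?P = (\<Prod>n=1..cf_denom \<alpha> i. 2 * \<bar>sin (pi * (real n * \<alpha> + real j * \<alpha>))\<bar>)"
    by (simp add: distrib_right)
  also have "\<dots> \<le> 2 * exp ?E"
    unfolding block_error_def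
    by (rule prod_abs_sin_block_le[OF cf_denom_pos cf_denom_pos coprime_cf cf_error_le])
  finally have "?P \<le> 2 * exp ?E" .
  moreover have "0 < ?P" by (intro prod_pos abs_sin_multiple_pos) auto
  ultimately have "ln ?P \<le> ln (2 * exp ?E)" by (rule ln_mono)
  also have "\<dots> = ln 2 + ?E" by (simp add: ln_mult del: cf_denom.simps)
  finally show ?thesis by (simp add: log_sin_sum_eq_ln_prod)
qed

lemma log_sin_sum_blocks_le:
  "log_sin_sum j (b * cf_denom \<alpha> i)
    \<le> real b * (ln 2 + real (cf_denom \<alpha> i) / real (cf_denom \<alpha> (Suc i)) * block_error i)"
proof (induction b)
  case 0
  then show ?case by (simp add: log_sin_sum_def)
next
  case (Suc b)
  have "log_sin_sum j (Suc b * cf_denom \<alpha> i)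
      = log_sin_sum j (b * cf_denom \<alpha> i) + log_sin_sum (j + b * cf_denom \<alpha> i) (cf_denom \<alpha> i)"
    using log_sin_sum_add[of j "b * cf_denom \<alpha> i" "cf_denom \<alpha> i"] by (simp add: add.commute)
  with Suc log_sin_sum_block_le[of "j + b * cf_denom \<alpha> i" i] show ?case
    by (simp add: distrib_right del: cf_denom.simps)
qed

text \<open>
  Ostrowski's greedy expansion: \<open>N < q\<^bsub>l+1\<^esub>\<close> is cut into at most \<open>q\<^bsub>l+1\<^esub> / q\<^sub>l\<close> blocks of length
  \<open>q\<^sub>l\<close>, whose errors add up to at most \<open>block_error l\<close>, and a remainder below \<open>q\<^sub>l\<close>.
\<close>

lemma log_sin_sum_le:
  "N < cf_denom \<alpha> (Suc l) \<Longrightarrow> log_sin_sum j N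
    \<le> ln 2 * (real N / real (cf_denom \<alpha> l) + (\<Sum>i<l. real (cf_denom \<alpha> (Suc i)) / real (cf_denom \<alpha> i)))
      + (\<Sum>i=1..l. block_error i)"
proof (induction l arbitrary: N j)
  case 0
  then show ?case using log_sin_sum_le_trivial[of j N] by (simp add: mult.commute)
next
  case (Suc l)
  let ?q = "cf_denom \<alpha> (Suc l)" and ?q' = "cf_denom \<alpha> (Suc (Suc l))" and ?L = "block_error (Suc l)"
  let ?S = "\<lambda>l. \<Sum>i<l. real (cf_denom \<alpha> (Suc i)) / real (cf_denom \<alpha> i)"
  define b N' where "b = N div ?q" and "N' = N mod ?q"
  have q: "?q > 0" "?q' > 0" "cf_denom \<alpha> l > 0" using cf_denom_pos by (auto simp: Suc_le_eq)
  have N: "N = b * ?q + N'" unfolding b_def N'_def by (rule div_mult_mod_eq[symmetric])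
  have N': "N' < ?q" using q by (simp add: N'_def)
  have bN: "real b * real ?q \<le> real N" unfolding N by simp
  have "log_sin_sum j N = log_sin_sum j (b * ?q) + log_sin_sum (j + b * ?q) N'"
    unfolding N by (rule log_sin_sum_add)
  also have "log_sin_sum j (b * ?q) \<le> real b * (ln 2 + real ?q / real ?q' * ?L)"
    by (rule log_sin_sum_blocks_le)
  also have "\<dots> = ln 2 * real b + (real b * real ?q) / real ?q' * ?L"
    by (simp add: algebra_simps del: cf_denom.simps)
  also have "\<dots> \<le> ln 2 * (real N / real ?q) + 1 * ?L"
  proof (intro add_mono mult_left_mono mult_right_mono block_error_nonneg)
    show "real b \<le> real N / real ?q" using bN q by (simp add: field_simps del: cf_denom.simps)
    have "real N \<le> real ?q'" using Suc.prems by linarith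
    with bN show "real b * real ?q / real ?q' \<le> 1" using q by (simp add: field_simps del: cf_denom.simps)
  qed auto
  also have "log_sin_sum (j + b * ?q) N' \<le> ln 2 * (real N' / real (cf_denom \<alpha> l) + ?S l) + (\<Sum>i=1..l. block_error i)"
    by (rule Suc.IH[OF N'])
  \<comment> \<open>The induction hypothesis counts N' / q_l blocks in the remainder; enlarging N'
    to q_{l+1} turns this into the new summand of \<open>?S (Suc l)\<close>.\<close>
  also have "\<dots> \<le> ln 2 * (real ?q / real (cf_denom \<alpha> l) + ?S l) + (\<Sum>i=1..l. block_error i)"
    using N' by (intro add_mono mult_left_mono divide_right_mono) auto
  finally show ?case by (simp add: algebra_simps del: cf_denom.simps)
qed

section \<open>Comparison of the greedy bound with the right-hand side of the theorem\<close>

definition discrepancy_bound :: "nat \<Rightarrow> real" where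
  "discrepancy_bound l = ln 2 * (1 / real (cf_denom \<alpha> l) + real l / 2 powr ((real l - 3) / 2))
    + 3 * (ln (real (cf_denom \<alpha> l)) / real (cf_denom \<alpha> l))
      * (ln (real (cf_denom \<alpha> l)) / ln golden_ratio + 1)"

lemma ln_golden_ratio_pos: "0 < ln golden_ratio"
proof -
  have "sqrt 5 > sqrt 1" by (intro real_sqrt_less_mono) simp
  then show ?thesis by (intro ln_gt_zero) (simp add: golden_ratio_def)
qed

lemma index_le_ln_cf_denom: "real l \<le> ln (real (cf_denom \<alpha> l)) / ln golden_ratio + 1"
proof (cases l)
  case 0
  then show ?thesis using ln_golden_ratio_pos ln_cf_denom_nonneg[of 0] by simp
next
  case (Suc m)
  have "golden_ratio > 0" by (simp add: golden_ratio_def add_pos_nonneg)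
  then have "ln (golden_ratio ^ m) \<le> ln (real (cf_denom \<alpha> (Suc m)))"
    by (intro ln_mono golden_ratio_power_le_cf_denom) auto
  then have "real m * ln golden_ratio \<le> ln (real (cf_denom \<alpha> (Suc m)))"
    using \<open>golden_ratio > 0\<close> by (simp add: ln_realpow del: cf_denom.simps)
  then show ?thesis
    using ln_golden_ratio_pos Suc by (simp add: field_simps del: cf_denom.simps)
qed

text \<open>For l = 0 the term 1 / q_0 = 1 suffices. For l = 1..9 it is l / 2^((l-3)/2) >= 1, which
  after squaring reads 2^l <= 8 l^2 and first fails at l = 10.\<close>

lemma ln_2_le_discrepancy_bound:
  assumes "l \<le> 9"
  shows "ln 2 \<le> discrepancy_bound l"
proof -
  let ?q = "real (cf_denom \<alpha> l)"
  have "1 \<le> 1 / ?q + real l / 2 powr ((real l - 3) / 2)"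
  proof (cases "l = 0")
    case False
    have "l = 1 \<or> l = 2 \<or> l = 3 \<or> l = 4 \<or> l = 5 \<or> l = 6 \<or> l = 7 \<or> l = 8 \<or> l = 9"
      using assms False by presburger
    then have "2 ^ l \<le> 8 * l ^ 2" by (elim disjE) simp_all
    then have "real (2 ^ l) \<le> real (8 * l ^ 2)" by (simp only: of_nat_le_iff)
    then have "2 ^ l / 8 \<le> (real l)\<^sup>2" by simp
    moreover have "(2 powr ((real l - 3) / 2))\<^sup>2 = 2 ^ l / (8::real)"
      by (simp add: power2_eq_square powr_diff powr_realpow flip: powr_add)
    ultimately have "(2 powr ((real l - 3) / 2))\<^sup>2 \<le> (real l)\<^sup>2" by linarith
    then have "2 powr ((real l - 3) / 2) \<le> real l" by (rule power2_le_imp_le) simp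
    then have "1 \<le> real l / 2 powr ((real l - 3) / 2)" by simp
    moreover have "0 \<le> 1 / ?q" by simp
    ultimately show ?thesis by linarith
  qed simp
  then have "ln 2 * 1 \<le> ln 2 * (1 / ?q + real l / 2 powr ((real l - 3) / 2))"
    by (intro mult_left_mono) auto
  moreover have "0 \<le> 3 * (ln ?q / ?q) * (ln ?q / ln golden_ratio + 1)"
    using ln_golden_ratio_pos ln_cf_denom_nonneg[of l] by (intro mult_nonneg_nonneg add_nonneg_nonneg divide_nonneg_nonneg) auto
  ultimately show ?thesis unfolding discrepancy_bound_def by linarith
qed

text \<open>Doubling is applied below i and above i + 1: q_i >= 2^m and q_l >= 2^m' q_{i+1}. The
  omitted step from i to i + 1 and the two roundings cost at most 3, hence the exponent (l - 3) /
  2.\<close>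

lemma cf_denom_ratio_le:
  assumes "i < l"
  shows "real (cf_denom \<alpha> (Suc i)) / real (cf_denom \<alpha> i)
    \<le> real (cf_denom \<alpha> l) / 2 powr ((real l - 3) / 2)"
proof -
  define m m' where "m = i div 2" and "m' = (l - Suc i) div 2"
  have "2 ^ m \<le> cf_denom \<alpha> i"
    using cf_denom_add_ge[of i 0] by (simp add: m_def)
  then have qi: "real (2 ^ m) \<le> real (cf_denom \<alpha> i)" by (simp only: of_nat_le_iff)
  have "2 ^ m' * cf_denom \<alpha> (Suc i) \<le> cf_denom \<alpha> l"
    using cf_denom_add_ge[of "l - Suc i" "Suc i"] assms by (simp add: m'_def del: cf_denom.simps)
  then have ql: "real (2 ^ m' * cf_denom \<alpha> (Suc i)) \<le> real (cf_denom \<alpha> l)" by (simp only: of_nat_le_iff)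
  have "l \<le> 2 * (m + m') + 3" using assms by (simp add: m_def m'_def)
  then have "(real l - 3) / 2 \<le> real (m + m')" by simp
  then have "2 powr ((real l - 3) / 2) \<le> 2 powr real (m + m')" by (intro powr_mono) auto
  also have "\<dots> = 2 ^ m * 2 ^ m'" by (simp only: powr_realpow power_add)
  finally have "real (cf_denom \<alpha> (Suc i)) * 2 powr ((real l - 3) / 2)
      \<le> real (cf_denom \<alpha> (Suc i)) * (2 ^ m * 2 ^ m')"
    by (intro mult_left_mono) auto
  also have "\<dots> = real (2 ^ m) * real (2 ^ m' * cf_denom \<alpha> (Suc i))" by (simp del: cf_denom.simps)
  also have "\<dots> \<le> real (cf_denom \<alpha> i) * real (cf_denom \<alpha> l)"
    by (intro mult_mono qi ql) auto
  finally show ?thesis using cf_denom_pos[of i] by (simp add: field_simps del: cf_denom.simps)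
qed

text \<open>The third logarithm absorbs the constant: pi/2 + 2 < 4 <= ln q_l.\<close>

lemma block_error_le:
  assumes "l \<ge> 10" "i \<le> l"
  shows "block_error i \<le> 3 * ln (real (cf_denom \<alpha> l))"
proof -
  have "exp (4::real) = exp 1 ^ 4" by (simp flip: exp_of_nat_mult)
  also have "\<dots> \<le> 3 ^ 4" by (intro power_mono exp_le) auto
  also have "\<dots> \<le> real (cf_denom \<alpha> l)" using cf_denom_ge_89[OF assms(1)] by simp
  finally have "4 \<le> ln (real (cf_denom \<alpha> l))" using cf_denom_pos[of l] by (subst ln_ge_iff) auto
  moreover have "ln (real (cf_denom \<alpha> i)) \<le> ln (real (cf_denom \<alpha> l))"
    using cf_denom_pos[of i] cf_denom_mono[OF assms(2)] by (intro ln_mono) auto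
  ultimately show ?thesis unfolding block_error_def using pi_less_4 by linarith
qed

theorem average_log_sin_le:
  assumes "cf_denom \<alpha> l \<le> N" "N < cf_denom \<alpha> (Suc l)"
  shows "log_sin_sum 0 N / real N \<le> discrepancy_bound l"
proof -
  let ?q = "real (cf_denom \<alpha> l)"
  have q: "0 < ?q" "?q \<le> real N" using cf_denom_pos[of l] assms by auto
  show ?thesis
  proof (cases "l \<le> 9")
    case True
    have "log_sin_sum 0 N / real N \<le> ln 2"
      using log_sin_sum_le_trivial[of 0 N] q by (simp add: field_simps)
    with ln_2_le_discrepancy_bound[OF True] show ?thesis by linarith
  next
    case False
    let ?S = "\<Sum>i<l. real (cf_denom \<alpha> (Suc i)) / real (cf_denom \<alpha> i)"
    have "?S \<le> (\<Sum>i<l. ?q / 2 powr ((real l - 3) / 2))"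
      by (intro sum_mono cf_denom_ratio_le) auto
    then have S: "?S \<le> ?q * (real l / 2 powr ((real l - 3) / 2))" by (simp add: mult.commute)
    have "(\<Sum>i=1..l. block_error i) \<le> (\<Sum>i=1..l. 3 * ln ?q)"
      using False by (intro sum_mono block_error_le) auto
    also have "\<dots> = 3 * ln ?q * real l" by simp
    also have "\<dots> \<le> 3 * ln ?q * (ln ?q / ln golden_ratio + 1)"
      using ln_cf_denom_nonneg[of l] by (intro mult_left_mono index_le_ln_cf_denom) auto
    finally have L: "(\<Sum>i=1..l. block_error i) \<le> \<dots>" .
    let ?A = "ln 2 * (real l / 2 powr ((real l - 3) / 2))
      + 3 * (ln ?q / ?q) * (ln ?q / ln golden_ratio + 1)"
    have A: "0 \<le> ?A"
      using ln_golden_ratio_pos ln_cf_denom_nonneg[of l]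
      by (intro mult_nonneg_nonneg add_nonneg_nonneg divide_nonneg_nonneg) auto
    have "log_sin_sum 0 N \<le> ln 2 * (real N / ?q + ?S) + (\<Sum>i=1..l. block_error i)"
      by (rule log_sin_sum_le[OF assms(2)])
    also have "\<dots> \<le> ln 2 * (real N / ?q + ?q * (real l / 2 powr ((real l - 3) / 2)))
        + 3 * ln ?q * (ln ?q / ln golden_ratio + 1)"
      using S L by (intro add_mono mult_left_mono) auto
    also have "\<dots> = ln 2 * (real N / ?q) + ?q * ?A"
      using q by (simp add: distrib_left)
    \<comment> \<open>Here q_l <= N enters, so that division by N removes the factor.\<close>
    also have "\<dots> \<le> ln 2 * (real N / ?q) + real N * ?A"
      using q A by (intro add_left_mono mult_right_mono) auto
    also have "\<dots> = real N * discrepancy_bound l"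
      by (simp add: discrepancy_bound_def algebra_simps)
    finally show ?thesis using q by (simp add: field_simps)
  qed
qed

section \<open>Passage to the limit superior\<close>

lemma filterlim_cf_denom: "filterlim (\<lambda>l. real (cf_denom \<alpha> l)) at_top sequentially"
proof -
  have "1 < golden_ratio" using real_sqrt_less_mono[of 1 5] by (simp add: golden_ratio_def)
  then have "filterlim (\<lambda>l. golden_ratio ^ l) at_top sequentially"
    by (intro filterlim_at_infinity_imp_filterlim_at_top filterlim_realpow_sequentially_gt1) auto
  then have "filterlim (\<lambda>l. real (cf_denom \<alpha> (Suc l))) at_top sequentially"
    by (rule filterlim_at_top_mono) (simp add: golden_ratio_power_le_cf_denom del: cf_denom.simps)
  then show ?thesis by (rule filterlim_sequentially_Suc[THEN iffD1])
qed

lemma discrepancy_bound_tendsto_0: "discrepancy_bound \<longlonglongrightarrow> 0"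
proof -
  define c where "c = ln golden_ratio"
  have c: "c > 0" unfolding c_def by (rule ln_golden_ratio_pos)
  have 1: "((\<lambda>x::real. ln 2 * (1 / x) + 3 * (ln x / x) * (ln x / c + 1)) \<longlongrightarrow> 0) at_top"
    using c by real_asymp
  have 2: "(\<lambda>l. ln 2 * (real l / 2 powr ((real l - 3) / 2))) \<longlonglongrightarrow> 0"
    by real_asymp
  have "(\<lambda>l. (ln 2 * (1 / real (cf_denom \<alpha> l)) + 3 * (ln (real (cf_denom \<alpha> l)) / real (cf_denom \<alpha> l))
      * (ln (real (cf_denom \<alpha> l)) / c + 1)) + ln 2 * (real l / 2 powr ((real l - 3) / 2))) \<longlonglongrightarrow> 0 + 0"
    by (intro tendsto_add 2 filterlim_compose[OF 1 filterlim_cf_denom])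
  then show ?thesis
    by (simp only: discrepancy_bound_def[abs_def] c_def distrib_left ac_simps add_0_left)
qed

lemma ex_cf_denom_interval:
  assumes "cf_denom \<alpha> L \<le> N"
  obtains l where "L \<le> l" "cf_denom \<alpha> l \<le> N" "N < cf_denom \<alpha> (Suc l)"
proof -
  have "eventually (\<lambda>l. real N < real (cf_denom \<alpha> l)) sequentially"
    using filterlim_cf_denom unfolding filterlim_at_top_dense by blast
  then obtain m where "real N < real (cf_denom \<alpha> m)"
    using eventually_happens by fastforce
  then have ex: "N < cf_denom \<alpha> (Suc m)" using cf_denom_le_Suc[of m] by linarith
  define l where "l = (LEAST l. N < cf_denom \<alpha> (Suc l))"
  have l: "N < cf_denom \<alpha> (Suc l)" unfolding l_def using ex by (rule LeastI)
  have "L \<le> l"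
    using l assms cf_denom_mono[of "Suc l" L] by (meson leD le_trans not_less_eq_eq)
  moreover have "cf_denom \<alpha> l \<le> N"
  proof (cases l)
    case 0
    then show ?thesis using assms cf_denom_mono[of 0 L] by simp
  next
    case (Suc k)
    then have "\<not> N < cf_denom \<alpha> (Suc k)" by (intro not_less_Least) (simp add: l_def)
    with Suc show ?thesis by simp
  qed
  ultimately show ?thesis using that l by blast
qed

lemma eventually_average_less:
  assumes "\<epsilon> > 0"
  shows "\<forall>\<^sub>F N in sequentially. log_sin_sum 0 N / real N < \<epsilon>"
proof -
  from order_tendstoD(2)[OF discrepancy_bound_tendsto_0 assms]
  obtain L where L: "discrepancy_bound l < \<epsilon>" if "l \<ge> L" for l
    by (auto simp: eventually_sequentially)
  have "log_sin_sum 0 N / real N < \<epsilon>" if "N \<ge> cf_denom \<alpha> L" for N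
  proof -
    obtain l where "L \<le> l" "cf_denom \<alpha> l \<le> N" "N < cf_denom \<alpha> (Suc l)"
      using ex_cf_denom_interval \<open>N \<ge> cf_denom \<alpha> L\<close> by blast
    then show ?thesis using average_log_sin_le[of l N] L[of l] by linarith
  qed
  then show ?thesis by (auto simp: eventually_sequentially)
qed

lemma log_sin_sum_ge:
  assumes "cf_denom \<alpha> l \<ge> 2"
  shows "- 3 * ln (real (cf_denom \<alpha> l)) \<le> log_sin_sum 0 (cf_denom \<alpha> l - 1)"
proof -
  let ?q = "cf_denom \<alpha> l"
  have "\<bar>real ?q * \<alpha> - of_int (cf_numer \<alpha> l)\<bar> \<le> 1 / real (cf_denom \<alpha> (Suc l))"
    by (rule cf_error_le)
  also have "\<dots> \<le> 1 / real ?q"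
    using cf_denom_le_Suc[of l] cf_denom_pos[of l] by (intro divide_left_mono) auto
  finally have "1 / real ?q ^ 3 \<le> (\<Prod>n=1..<?q. 2 * \<bar>sin (pi * (real n * \<alpha>))\<bar>)"
    by (intro prod_abs_sin_ge[OF assms coprime_cf])
  moreover have "{1..<?q} = {1..?q - 1}" using assms by auto
  ultimately have "1 / real ?q ^ 3 \<le> (\<Prod>n=1..?q - 1. 2 * \<bar>sin (pi * (real (n + 0) * \<alpha>))\<bar>)" by simp
  then have "ln (1 / real ?q ^ 3) \<le> log_sin_sum 0 (?q - 1)"
    unfolding log_sin_sum_eq_ln_prod using assms by (intro ln_mono) auto
  moreover have "ln (1 / real ?q ^ 3) = - 3 * ln (real ?q)"
    using assms by (simp add: ln_div ln_realpow)
  ultimately show ?thesis by simp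
qed

lemma limsup_average_log_sin: "limsup (\<lambda>N. ereal (log_sin_sum 0 N / real N)) = 0"
proof (rule antisym)
  show "limsup (\<lambda>N. ereal (log_sin_sum 0 N / real N)) \<le> 0"
  proof (rule ereal_le_epsilon2)
    fix \<epsilon> :: real assume "0 < \<epsilon>"
    from eventually_average_less[OF this]
    have "\<forall>\<^sub>F N in sequentially. ereal (log_sin_sum 0 N / real N) \<le> ereal \<epsilon>"
      by (rule eventually_mono) simp
    then show "limsup (\<lambda>N. ereal (log_sin_sum 0 N / real N)) \<le> 0 + ereal \<epsilon>"
      by (simp add: Limsup_bounded)
  qed
  show "0 \<le> limsup (\<lambda>N. ereal (log_sin_sum 0 N / real N))"
  \<comment> \<open>A negative limit superior would put all late averages below some c < 0. Along N
    = q_l - 1, which tends to infinity, they are at least -3 ln q_l / (q_l - 1), and this tends to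
    0.\<close>
  proof (rule ccontr)
    assume "\<not> 0 \<le> limsup (\<lambda>N. ereal (log_sin_sum 0 N / real N))"
    then have "limsup (\<lambda>N. ereal (log_sin_sum 0 N / real N)) < 0" by (simp only: not_le)
    from dense[OF this] obtain c :: ereal where c: "limsup (\<lambda>N. ereal (log_sin_sum 0 N / real N)) < c" "c < 0"
      by blast
    from Limsup_lessD[OF c(1)] have ev: "\<forall>\<^sub>F N in sequentially. ereal (log_sin_sum 0 N / real N) < c" .
    have lim: "((\<lambda>x::real. - 3 * ln x / (x - 1)) \<longlongrightarrow> 0) at_top" by real_asymp
    have "(\<lambda>l. ereal (- 3 * ln (real (cf_denom \<alpha> l)) / (real (cf_denom \<alpha> l) - 1))) \<longlonglongrightarrow> ereal 0"
      by (intro tendsto_ereal filterlim_compose[OF lim filterlim_cf_denom])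
    then have ev1: "\<forall>\<^sub>F l in sequentially. c < ereal (- 3 * ln (real (cf_denom \<alpha> l)) / (real (cf_denom \<alpha> l) - 1))"
      using c(2) by (intro order_tendstoD) (auto simp: zero_ereal_def)
    have "filterlim (\<lambda>x. x - 1 :: real) at_top at_top" by real_asymp
    from filterlim_compose[OF this filterlim_cf_denom]
    have "filterlim (\<lambda>l. real (cf_denom \<alpha> l) - 1) at_top sequentially" .
    then have "filterlim (\<lambda>l. real (cf_denom \<alpha> l - 1)) at_top sequentially"
      using cf_denom_pos by (simp add: of_nat_diff)
    then have "filterlim (\<lambda>l. cf_denom \<alpha> l - 1) sequentially sequentially"
      by (simp add: filterlim_sequentially_iff_filterlim_real)
    from filterlim_iff[THEN iffD1, OF this, rule_format, OF ev]
    have ev2: "\<forall>\<^sub>F l in sequentially. ereal (log_sin_sum 0 (cf_denom \<alpha> l - 1) / real (cf_denom \<alpha> l - 1)) < c" .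
    have ev3: "\<forall>\<^sub>F l in sequentially. 2 \<le> real (cf_denom \<alpha> l)"
      using filterlim_cf_denom unfolding filterlim_at_top by blast
    from eventually_conj[OF ev1 eventually_conj[OF ev2 ev3]]
    obtain l where l: "c < ereal (- 3 * ln (real (cf_denom \<alpha> l)) / (real (cf_denom \<alpha> l) - 1))"
      "ereal (log_sin_sum 0 (cf_denom \<alpha> l - 1) / real (cf_denom \<alpha> l - 1)) < c" "2 \<le> real (cf_denom \<alpha> l)"
      using eventually_happens by fastforce
    have "real (cf_denom \<alpha> l - 1) = real (cf_denom \<alpha> l) - 1"
      using cf_denom_pos[of l] by (simp add: of_nat_diff)
    moreover have "- 3 * ln (real (cf_denom \<alpha> l)) / real (cf_denom \<alpha> l - 1)
        \<le> log_sin_sum 0 (cf_denom \<alpha> l - 1) / real (cf_denom \<alpha> l - 1)"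
      using l(3) by (intro divide_right_mono log_sin_sum_ge) auto
    ultimately have "- 3 * ln (real (cf_denom \<alpha> l)) / (real (cf_denom \<alpha> l) - 1)
        \<le> log_sin_sum 0 (cf_denom \<alpha> l - 1) / real (cf_denom \<alpha> l - 1)"
      by simp
    with l show False by (metis ereal_less_eq(3) less_le_trans not_less_iff_gr_or_eq order.strict_trans1)
  qed
qed

end

section \<open>The integral of the logarithm of the sine\<close>

lemma continuous_on_mult_ln: "continuous_on {0..1} (\<lambda>x::real. x * ln x)"
  unfolding continuous_on_eq_continuous_within
proof
  fix x :: real assume x: "x \<in> {0..1}"
  show "continuous (at x within {0..1}) (\<lambda>x. x * ln x)"
  proof (cases "x = 0")
    case True
    have "((\<lambda>x::real. x * ln x) \<longlongrightarrow> 0) (at_right 0)" by real_asymp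
    then show ?thesis using True by (simp add: continuous_within at_within_Icc_at_right)
  next
    case False
    then show ?thesis by (intro continuous_intros) auto
  qed
qed

text \<open>The explicit antiderivative \<open>F\<close> is continuous up to the endpoints because x
  ln x tends to 0 there, in agreement with the value 0 at x = 0.\<close>

lemma integrable_log_majorant: "(\<lambda>x::real. ln 4 - ln x - ln (1 - x)) integrable_on {0..1}"
proof -
  define F where "F x = x * (ln 4 + 2) - x * ln x + (1 - x) * ln (1 - x)" for x :: real
  have "continuous_on {0..1} (\<lambda>x. (1 - x) * ln (1 - x) :: real)"
    by (rule continuous_on_compose2[OF continuous_on_mult_ln]) (auto intro!: continuous_intros)
  then have "continuous_on {0..1} F"
    unfolding F_def
    by (intro continuous_on_add continuous_on_diff continuous_on_mult_ln) (auto intro!: continuous_intros)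
  moreover have "(F has_vector_derivative ln 4 - ln x - ln (1 - x)) (at x)" if "x \<in> {0<..<1}" for x
    unfolding F_def has_real_derivative_iff_has_vector_derivative[symmetric] using that
    by (auto intro!: derivative_eq_intros)
  ultimately have "((\<lambda>x. ln 4 - ln x - ln (1 - x)) has_integral F 1 - F 0) {0..1}"
    by (intro fundamental_theorem_of_calculus_interior) auto
  then show ?thesis by blast
qed

lemma sin_pi_ge:
  assumes "0 \<le> x" "x \<le> 1"
  shows "2 * x * (1 - x) \<le> sin (pi * x)"
proof -
  have half: "2 * u * (1 - u) \<le> sin (pi * u)" if "0 \<le> u" "u \<le> 1/2" for u
  proof -
    have "2 * u * (1 - u) \<le> 2 * u * 1" using that by (intro mult_left_mono) auto
    also have "\<dots> \<le> sin (pi * u)"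
      using sin_mult_ge[of "pi / 2" "2 * u"] that by (simp add: mult.commute)
    finally show ?thesis .
  qed
  show ?thesis
  proof (cases "x \<le> 1/2")
    case False
    have "sin (pi * (1 - x)) = sin (pi * x)" by (simp add: right_diff_distrib sin_diff)
    with half[of "1 - x"] False assms show ?thesis by (simp add: algebra_simps)
  qed (use half assms in auto)
qed

text \<open>Without integrability the value 0 would say nothing, as \<open>integral\<close> is 0 by
  default. The majorant comes from 2 sin (pi x) >= 4 x (1 - x); its + ln 4 also covers the upper
  bound ln 2.\<close>

lemma log_sin_absolutely_integrable:
  "(\<lambda>x::real. ln (2 * sin (pi * x))) absolutely_integrable_on {0..1}"
proof (rule measurable_bounded_by_integrable_imp_absolutely_integrable[OF _ _ integrable_log_majorant])
  have "(\<lambda>x::real. ln (2 * sin (pi * x))) \<in> borel_measurable borel" by measurable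
  then have "(\<lambda>x::real. ln (2 * sin (pi * x))) \<in> borel_measurable lebesgue"
    by (simp add: measurable_completion)
  then show "(\<lambda>x::real. ln (2 * sin (pi * x))) \<in> borel_measurable (lebesgue_on {0..1})"
    by (rule measurable_restrict_space1)
  show "{0..1::real} \<in> sets lebesgue" by simp
  fix x :: real assume x: "x \<in> {0..1}"
  show "norm (ln (2 * sin (pi * x))) \<le> ln 4 - ln x - ln (1 - x)"
  \<comment> \<open>At the endpoints the inequality rests on the default value ln 0 = 0.\<close>
  proof (cases "x = 0 \<or> x = 1")
    case False
    then have x: "0 < x" "x < 1" using x by auto
    have "0 < 2 * x * (1 - x)" using x by simp
    then have pos: "0 < sin (pi * x)" using sin_pi_ge[of x] x by linarith
    have le: "ln x \<le> 0" "ln (1 - x) \<le> 0" using x by auto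
    have "ln (2 * sin (pi * x)) \<le> ln 2" using pos by (intro ln_mono) auto
    also have "ln 2 \<le> ln (4::real)" by simp
    finally have upper: "ln (2 * sin (pi * x)) \<le> ln 4 - ln x - ln (1 - x)" using le by linarith
    have "ln (4 * x * (1 - x)) \<le> ln (2 * sin (pi * x))"
      using sin_pi_ge[of x] x by (intro ln_mono) auto
    moreover have "ln (4 * x * (1 - x)) = ln 4 + ln x + ln (1 - x)" using x by (simp add: ln_mult)
    moreover have "0 \<le> ln (4::real)" by simp
    ultimately have "- (ln 4 - ln x - ln (1 - x)) \<le> ln (2 * sin (pi * x))" by linarith
    with upper show ?thesis by (simp add: abs_le_iff)
  qed auto
qed

text \<open>The duplication formula \<open>f (2 x) = f x + f (x + 1/2)\<close> makes the integral equal to its double.\<close>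

lemma integral_log_sin: "integral {0..1} (\<lambda>x::real. ln (2 * sin (pi * x))) = 0"
proof -
  define f :: "real \<Rightarrow> real" where "f x = ln (2 * sin (pi * x))" for x
  define I where "I = integral {0..1} f"
  have int: "f integrable_on {0..1}"
    using log_sin_absolutely_integrable unfolding f_def by (rule absolutely_integrable_on_def[THEN iffD1, THEN conjunct1])
  then have "(f has_integral I) {0..1}" unfolding I_def by (rule integrable_integral)
  from has_integral_affinity'[of f I 0 1 2 0] this
  have dbl: "((\<lambda>x. f (2 * x)) has_integral I / 2) {0..1/2}" by simp
  have "f integrable_on {0..1/2}" "f integrable_on {1/2..1}"
    using int by (auto elim: integrable_subinterval_real)
  then obtain A B where AB: "(f has_integral A) {0..1/2}" "(f has_integral B) {1/2..1}" by blast
  from has_integral_combine[OF _ _ AB] have "(f has_integral A + B) {0..1}" by simp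
  then have I: "I = A + B" unfolding I_def by (rule integral_unique)
  from has_integral_affinity'[of f B "1/2" 1 1 "1/2"] AB(2)
  have "((\<lambda>x. f (x + 1/2)) has_integral B) {0..1/2}" by simp
  from has_integral_add[OF AB(1) this]
  have "((\<lambda>x. f x + f (x + 1/2)) has_integral I) {0..1/2}" by (simp add: I)
  then have "((\<lambda>x. f (2 * x)) has_integral I) {0..1/2}"
  \<comment> \<open>At 0 and 1/2 the duplication formula fails because of ln 0 = 0: its right-hand
    side is ln 2 and its left-hand side 0.\<close>
  proof (rule has_integral_spike_finite[rotated 2])
    show "finite {0, 1/2 :: real}" by simp
    fix x :: real assume "x \<in> {0..1/2} - {0, 1/2}"
    then have x: "0 < x" "x < 1/2" by auto
    then have "0 < pi * x" "pi * x < pi * (1/2)" by (simp, intro mult_strict_left_mono) auto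
    then have pos: "0 < sin (pi * x)" "0 < cos (pi * x)"
      by (auto intro!: sin_gt_zero cos_gt_zero simp: algebra_simps)
    have "sin (pi * (x + 1/2)) = cos (pi * x)" by (simp add: distrib_left sin_add)
    then have "f x + f (x + 1/2) = ln ((2 * sin (pi * x)) * (2 * cos (pi * x)))"
      using pos unfolding f_def by (subst ln_mult) auto
    also have "(2 * sin (pi * x)) * (2 * cos (pi * x)) = 2 * sin (pi * (2 * x))"
      using sin_double[of "pi * x"] by (simp add: mult.left_commute)
    finally show "f (2 * x) = f x + f (x + 1/2)" by (simp add: f_def)
  qed
  with dbl have "I / 2 = I" by (rule has_integral_unique)
  then show ?thesis by (simp add: I_def f_def[abs_def])
qed

theorem corollary1:
  fixes \<alpha> :: real
  assumes "\<alpha> \<in> {0..1}" and "\<alpha> \<notin> \<rat>"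
  shows
    "(\<forall>l N. cf_denom \<alpha> l \<le> N \<and> N < cf_denom \<alpha> (Suc l) \<longrightarrow>
        1 / real N * (\<Sum>n=1..N. ln \<bar>2 * sin (pi * real n * \<alpha>)\<bar>)
          \<le> ln 2 * (1 / real (cf_denom \<alpha> l) + real l / 2 powr ((real l - 3) / 2))
            + 3 * (ln (real (cf_denom \<alpha> l)) / real (cf_denom \<alpha> l))
                * (ln (real (cf_denom \<alpha> l)) / ln golden_ratio + 1))
     \<and> limsup (\<lambda>N. ereal (1 / real N * (\<Sum>n=1..N. ln \<bar>2 * sin (pi * real n * \<alpha>)\<bar>))) = 0
     \<and> (\<lambda>x::real. ln (2 * sin (pi * x))) absolutely_integrable_on {0..1}
     \<and> 0 = integral {0..1} (\<lambda>x::real. ln (2 * sin (pi * x)))"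
proof -
  have "\<alpha> \<noteq> 0" "\<alpha> \<noteq> 1" using assms(2) by auto
  then interpret unit_irrational \<alpha>
    using assms by unfold_locales auto
  have average: "1 / real N * (\<Sum>n=1..N. ln \<bar>2 * sin (pi * real n * \<alpha>)\<bar>) = log_sin_sum 0 N / real N" for N
    by (simp add: log_sin_sum_def abs_mult mult.assoc)
  then show ?thesis
    using average_log_sin_le limsup_average_log_sin log_sin_absolutely_integrable integral_log_sin
    unfolding average discrepancy_bound_def[symmetric] by auto
qed

end
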